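(* Let $\varphi \in [0,1)$ and let $f : \mathbb{N} \to \mathbb{R}$ be such that $\sum_{n \ge 1} |\Delta^2 f(n)| < \infty$. Then $\Delta f(n) \to \psi$ as $n \to \infty$ for some $\psi \in \mathbb{R}$. If $\psi + \varphi \notin \mathbb{Z}$ and $y_n = e(f(n))$ for $n \ge 1$, then every solution $\{x_n\}_{n\ge1} \subset \mathbb{C}$ (i.e. for every initial value $x_1 \in \mathbb{C}$) of the difference equation $$x_{n+1} = e(-\varphi)\,x_n + y_n, \quad n \ge 1,$$ is bounded.
   Context: $\mathbb{N} = \{1,2,3,\ldots\}$. For real $x$, $e(x) := e^{2\pi i x}$. For $f : \mathbb{N} \to \mathbb{R}$, $\Delta f(n) := f(n+1) - f(n)$ and $\Delta^2 f(n) := \Delta f(n+1) - \Delta f(n) = f(n+2) - 2f(n+1) + f(n)$. *)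

theory Defs
  imports "HOL-Analysis.Analysis"
begin

(* Sequences indexed by {1, 2, 3, ...} are functions on nat whose value at 0 is irrelevant. *)

definition unit_exp :: "real \<Rightarrow> complex" where
  "unit_exp x = exp (2 * complex_of_real pi * \<i> * complex_of_real x)"

definition fwd_diff :: "(nat \<Rightarrow> real) \<Rightarrow> nat \<Rightarrow> real" where
  "fwd_diff f n = f (n + 1) - f n"

definition fwd_diff2 :: "(nat \<Rightarrow> real) \<Rightarrow> nat \<Rightarrow> real" where
  "fwd_diff2 f n = fwd_diff f (n + 1) - fwd_diff f n"

end

(* Put u n = e(f n + n phi), d n = e(\<Delta>f n + phi) and w n = 1 / (d n - 1). After rotating x n to
   z n = e(n phi) x n, the equation reads z (n+1) = z n + e(phi) u n. As u (n+1) = d n u n, one has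
   u n = w n (u (n+1) - u n), and hence v n = z n - e(phi) w n u n satisfies
   v (n+1) - v n = e(phi) (w n - w (n+1)) u (n+1). Since d n tends to e(psi + phi) \<noteq> 1, the sequence w
   is eventually bounded with |w (n+1) - w n| = O(|\<Delta>^2 f n|), which is summable; so v converges and
   z is bounded. *)

theory Submission
  imports Defs
begin

lemma unit_exp_add: "unit_exp (a + b) = unit_exp a * unit_exp b"
  by (simp add: unit_exp_def exp_add[symmetric] algebra_simps)

lemma unit_exp_0 [simp]: "unit_exp 0 = 1"
  by (simp add: unit_exp_def)

lemma norm_unit_exp [simp]: "norm (unit_exp a) = 1"
  by (simp add: unit_exp_def)

lemma unit_exp_eq_1_iff: "unit_exp a = 1 \<longleftrightarrow> a \<in> \<int>"
  by (auto simp: unit_exp_def exp_eq_1 Ints_def)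

lemma tendsto_unit_exp: "(f \<longlongrightarrow> a) F \<Longrightarrow> ((\<lambda>n. unit_exp (f n)) \<longlongrightarrow> unit_exp a) F"
  unfolding unit_exp_def by (intro tendsto_intros)

lemma norm_unit_exp_minus_1: "norm (unit_exp a - 1) = 2 * \<bar>sin (pi * a)\<bar>"
  using dist_exp_i_1[of "2 * (pi * a)"] by (simp add: unit_exp_def mult_ac)

text \<open>Taking out a unimodular factor moves the chord to one ending at 1, of length 2 |sin(pi
  (a - b))|, and |sin t| \<le> |t|. This turns second differences of \<open>f\<close> into bounds on
  the steps of \<open>d\<close>.\<close>

lemma norm_unit_exp_diff_le: "norm (unit_exp a - unit_exp b) \<le> 2 * pi * \<bar>a - b\<bar>"
proof -
  have "unit_exp a - unit_exp b = unit_exp b * (unit_exp (a - b) - 1)"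
    using unit_exp_add[of b "a - b"] by (simp add: algebra_simps)
  then have "norm (unit_exp a - unit_exp b) = norm (unit_exp (a - b) - 1)"
    by (simp add: norm_mult)
  also have "\<dots> = 2 * \<bar>sin (pi * (a - b))\<bar>"
    by (rule norm_unit_exp_minus_1)
  also have "\<dots> \<le> 2 * \<bar>pi * (a - b)\<bar>"
    using abs_sin_x_le_abs_x by (intro mult_left_mono) auto
  finally show ?thesis
    by (simp add: abs_mult)
qed

text \<open>The differences telescope to \<open>a n - a 0\<close>, and absolute convergence implies
  convergence in a Banach space. Serves both for \<Delta>f and for the corrected sequence
  \<open>v\<close>.\<close>

lemma convergent_if_summable_norm_diff:
  fixes a :: "nat \<Rightarrow> 'a::banach"
  assumes "summable (\<lambda>n. norm (a (Suc n) - a n))"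
  shows "convergent a"
proof -
  have "convergent (\<lambda>n. a n - a 0)"
    using summable_norm_cancel[OF assms]
    by (simp add: summable_iff_convergent sum_lessThan_telescope)
  then have "convergent (\<lambda>n. (a n - a 0) + a 0)"
    by (intro convergent_add convergent_const)
  then show ?thesis by simp
qed

lemma Bseq_solution:
  fixes f :: "nat \<Rightarrow> real" and x :: "nat \<Rightarrow> complex"
  assumes summ: "summable (\<lambda>n. \<bar>fwd_diff2 f n\<bar>)"
    and lim: "fwd_diff f \<longlonglongrightarrow> \<psi>"
    and nonint: "\<psi> + \<phi> \<notin> \<int>"
    and rec: "\<forall>n\<ge>1. x (n + 1) = unit_exp (- \<phi>) * x n + unit_exp (f n)"
  shows "Bseq x"
proof -
  define u where "u n = unit_exp (f n + real n * \<phi>)" for n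
  define d where "d n = unit_exp (fwd_diff f n + \<phi>)" for n
  define w where "w n = 1 / (d n - 1)" for n
  define z where "z n = unit_exp (real n * \<phi>) * x n" for n
  define v where "v n = z n - unit_exp \<phi> * w n * u n" for n
  define L where "L = unit_exp (\<psi> + \<phi>) - 1"
  have L: "L \<noteq> 0"
    using nonint by (simp add: L_def unit_exp_eq_1_iff)
  have dlim: "(\<lambda>n. d n - 1) \<longlonglongrightarrow> L"
    unfolding d_def L_def by (intro tendsto_intros tendsto_unit_exp lim)
  have wlim: "w \<longlonglongrightarrow> 1 / L"
    unfolding w_def by (intro tendsto_intros dlim L)
  have d_ne: "\<forall>\<^sub>F n in sequentially. d n - 1 \<noteq> 0"
    using tendsto_imp_eventually_ne[OF dlim L] .
  have d_ne': "\<forall>\<^sub>F n in sequentially. d (Suc n) - 1 \<noteq> 0"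
    using d_ne eventually_sequentially_Suc[of "\<lambda>n. d n - 1 \<noteq> 0"] by simp
  \<comment> \<open>Since 1 / 0 = 0, \<open>w n\<close> has a value even where
    \<open>d n = 1\<close>; being convergent, \<open>w\<close> is bounded at every index, not just
    eventually.\<close>
  obtain B where B: "B > 0" "\<And>n. norm (w n) \<le> B"
    using convergent_imp_Bseq[OF convergentI[OF wlim]] by (auto simp: Bseq_def)
  have u_step: "u (Suc n) = d n * u n" for n
    by (simp add: u_def d_def fwd_diff_def unit_exp_add[symmetric] algebra_simps)
  have z_step: "z (Suc n) = z n + unit_exp \<phi> * u n" if "n \<ge> 1" for n
  proof -
    have "unit_exp (real (Suc n) * \<phi>) * unit_exp (- \<phi>) = unit_exp (real n * \<phi>)"
      by (simp add: unit_exp_add[symmetric] algebra_simps)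
    moreover have "unit_exp (real (Suc n) * \<phi>) * unit_exp (f n) = unit_exp \<phi> * u n"
      by (simp add: u_def unit_exp_add[symmetric] algebra_simps)
    moreover have "x (Suc n) = unit_exp (- \<phi>) * x n + unit_exp (f n)"
      using rec that by simp
    ultimately show ?thesis
      by (simp only: z_def distrib_left mult.assoc[symmetric])
  qed
  \<comment> \<open>Eventually \<open>w n\<close> and \<open>w (Suc n)\<close> are both true
    reciprocals. Here \<open>B * B\<close> bounds their product and \<open>2 * pi\<close> is the
    Lipschitz constant of \<open>unit_exp\<close>; the doubled norm is the shape the comparison test
    expects.\<close>
  have "\<forall>\<^sub>F n in sequentially. norm (norm (v (Suc n) - v n)) \<le> B * B * (2 * pi) * \<bar>fwd_diff2 f n\<bar>"
    using d_ne d_ne' eventually_ge_at_top[of 1]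
  proof eventually_elim
    case (elim n)
    have "w n * (u (Suc n) - u n) = u n"
      using elim by (simp add: w_def u_step field_simps)
    \<comment> \<open>Summation by parts: with \<open>u n\<close> rewritten as \<open>w n\<close>
      times a difference, the two \<open>w n * u n\<close> terms cancel and only the variation of
      \<open>w\<close> survives.\<close>
    then have "v (Suc n) - v n = unit_exp \<phi> * (w n * (u (Suc n) - u n))
        + unit_exp \<phi> * w n * u n - unit_exp \<phi> * w (Suc n) * u (Suc n)"
      using z_step[OF elim(3)] by (simp add: v_def)
    then have "v (Suc n) - v n = unit_exp \<phi> * (w n - w (Suc n)) * u (Suc n)"
      by (simp add: algebra_simps)
    then have "norm (v (Suc n) - v n) = norm (w n - w (Suc n))"
      by (simp add: norm_mult u_def)
    \<comment> \<open>1/a - 1/b = (b - a)/(a b), which passes from the variation of \<open>w\<close>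
      to that of \<open>d\<close>.\<close>
    also have "w n - w (Suc n) = w n * w (Suc n) * (d (Suc n) - d n)"
      using elim by (simp add: w_def field_simps)
    also have "norm \<dots> \<le> B * B * (2 * pi * \<bar>fwd_diff2 f n\<bar>)"
      unfolding norm_mult
      using norm_unit_exp_diff_le[of "fwd_diff f (Suc n) + \<phi>" "fwd_diff f n + \<phi>"] B
      by (intro mult_mono) (auto simp: d_def fwd_diff2_def)
    finally show ?case by simp
  qed
  then have "summable (\<lambda>n. norm (v (Suc n) - v n))"
    using summable_mult[OF summ] by (rule summable_comparison_test_ev)
  then obtain V where V: "\<And>n. norm (v n) \<le> V"
    using convergent_imp_Bseq[OF convergent_if_summable_norm_diff] by (auto simp: Bseq_def)
  \<comment> \<open>Rotation preserves the modulus, so \<open>x n\<close> has the norm of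
    \<open>z n\<close>, and the correction separating \<open>z n\<close> from \<open>v n\<close> has
    norm at most \<open>B\<close>.\<close>
  have "norm (x n) \<le> V + B" for n
  proof -
    have "norm (x n) = norm (v n + unit_exp \<phi> * w n * u n)"
      by (simp add: v_def z_def norm_mult)
    also have "\<dots> \<le> norm (v n) + norm (unit_exp \<phi> * w n * u n)"
      by (rule norm_triangle_ineq)
    also have "\<dots> \<le> V + B"
      using V[of n] B(2)[of n] by (simp add: norm_mult u_def)
    finally show ?thesis .
  qed
  then show ?thesis by (rule BseqI')
qed

theorem theorem2p13:
  fixes \<phi> :: real and f :: "nat \<Rightarrow> real"
  assumes "\<phi> \<in> {0..<1}"
    and "summable (\<lambda>n. \<bar>fwd_diff2 f (Suc n)\<bar>)"
  shows "\<exists>\<psi>::real. fwd_diff f \<longlonglongrightarrow> \<psi> \<and>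
    (\<psi> + \<phi> \<notin> \<int> \<longrightarrow>
      (\<forall>y :: nat \<Rightarrow> complex. (\<forall>n\<ge>1. y n = unit_exp (f n)) \<longrightarrow>
        (\<forall>x :: nat \<Rightarrow> complex.
          (\<forall>n\<ge>1. x (n + 1) = unit_exp (- \<phi>) * x n + y n) \<longrightarrow> bounded (x ` {1..}))))"
proof -
  \<comment> \<open>The hypothesis sums from index 1; one further term, at index 0, keeps
    summability.\<close>
  have summ: "summable (\<lambda>n. \<bar>fwd_diff2 f n\<bar>)"
    using assms(2) by (subst (asm) summable_Suc_iff)
  then have "convergent (fwd_diff f)"
    by (intro convergent_if_summable_norm_diff) (simp add: fwd_diff2_def)
  then obtain \<psi> where lim: "fwd_diff f \<longlonglongrightarrow> \<psi>"
    by (auto simp: convergent_def)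
  have "bounded (x ` {1..})"
    if "\<psi> + \<phi> \<notin> \<int>" "\<forall>n\<ge>1. y n = unit_exp (f n)"
      "\<forall>n\<ge>1. x (n + 1) = unit_exp (- \<phi>) * x n + y n"
    for x y :: "nat \<Rightarrow> complex"
  proof -
    have "Bseq x"
      using that by (intro Bseq_solution[OF summ lim that(1)]) simp
    \<comment> \<open>\<open>Bseq\<close> also covers the arbitrary value \<open>x 0\<close>;
      passing to indices from 1 on only shrinks the range.\<close>
    then show ?thesis
      by (auto simp: Bseq_eq_bounded intro: bounded_subset)
  qed
  with lim show ?thesis by blast
qed

end
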